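(* Let $f(\rho)=\operatorname{Tr}[\rho\,\Omega(\rho)]$ be convex and differentiable on $\mathcal M$, let $f_*:=\min_{\sigma\in\mathcal M}f(\sigma)$, and define for $\rho\in\mathcal M$ $$\epsilon(\rho):=\operatorname{dist}_2(\nabla f(\rho),N_{\mathcal M}),\qquad R_{\mathcal M}(\rho):=\sup_{\sigma\in\mathcal M}\|\rho-\sigma\|_2 .$$ Then for every $\rho\in\mathcal M$, $$0\le f(\rho)-f_*\le R_{\mathcal M}(\rho)\,\epsilon(\rho)\le\sqrt2\,\epsilon(\rho).$$
   Context: $\mathcal H$ is a finite-dimensional complex Hilbert space, $\mathcal B(\mathcal H)$ the real space of Hermitian operators with Hilbert–Schmidt inner product $\langle X,Y\rangle=\operatorname{Tr}(XY)$ and norm $\|X\|_2=\sqrt{\operatorname{Tr}X^2}$, $\mathcal S(\mathcal H)$ the set of density operators. $H_1,\dots,H_k\in\mathcal B(\mathcal H)$ and $c\in\mathbb R^k$ are given, with $\{I,H_1,\dots,H_k\}$ linearly independent, and $\mathcal M=\{\rho\in\mathcal S(\mathcal H):\operatorname{Tr}(\rho H_j)=c_j,\ j=1,\dots,k\}$ is assumed to contain a positive-definite state. $T_{\mathcal M}=\{X\in\mathcal B(\mathcal H):\operatorname{Tr}X=0,\ \operatorname{Tr}(XH_j)=0\ \forall j\}$ and $N_{\mathcal M}=T_{\mathcal M}^\perp=\operatorname{span}\{I,H_1,\dots,H_k\}$. $\Omega:\mathcal S(\mathcal H)\to\mathcal B(\mathcal H)$ is continuous. Differentiability of $f$ is relative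 to the affine hull of $\mathcal M$: $\nabla f(\rho)\in\mathcal B(\mathcal H)$ denotes an operator with $f(\sigma)=f(\rho)+\operatorname{Tr}[\nabla f(\rho)(\sigma-\rho)]+o(\|\sigma-\rho\|)$ as $\sigma\to\rho$ in $\mathcal M$ (determined up to adding elements of $N_{\mathcal M}$). $\operatorname{dist}_2(Y,N_{\mathcal M})=\inf_{Z\in N_{\mathcal M}}\|Y-Z\|_2=\|P_TY\|_2$, where $P_T$ is the orthogonal projection onto $T_{\mathcal M}$. *)

theory Defs
  imports "HOL-Analysis.Analysis"
begin

text \<open>
  The Hilbert space is \<open>complex ^ 'n\<close> with its standard inner product, operators on it are
  square matrices.  \<open>complex ^ 'n ^ 'n\<close> is regarded as a real vector space; the Hermitian
  matrices are a real subspace of it, and \<open>independent\<close> and \<open>span\<close> below are taken over the reals.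
\<close>

definition hermitian :: "complex ^ 'n ^ 'n \<Rightarrow> bool" where
  "hermitian A \<longleftrightarrow> (\<forall>i j. A $ i $ j = cnj (A $ j $ i))"

definition quad_form :: "complex ^ 'n ^ 'n \<Rightarrow> complex ^ 'n \<Rightarrow> complex" where
  "quad_form A v = (\<Sum>i\<in>UNIV. cnj (v $ i) * (A *v v) $ i)"

definition pos_semidef :: "complex ^ 'n ^ 'n \<Rightarrow> bool" where
  "pos_semidef A \<longleftrightarrow> hermitian A \<and> (\<forall>v. 0 \<le> Re (quad_form A v))"

definition pos_definite :: "complex ^ 'n ^ 'n \<Rightarrow> bool" where
  "pos_definite A \<longleftrightarrow> hermitian A \<and> (\<forall>v. v \<noteq> 0 \<longrightarrow> 0 < Re (quad_form A v))"

definition density_ops :: "(complex ^ 'n ^ 'n) set" where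
  "density_ops = {\<rho>. pos_semidef \<rho> \<and> trace \<rho> = 1}"

text \<open>Traces of products of two Hermitian matrices are real, so nothing is lost by \<open>Re\<close>.\<close>

definition hs_inner :: "complex ^ 'n ^ 'n \<Rightarrow> complex ^ 'n ^ 'n \<Rightarrow> real" where
  "hs_inner X Y = Re (trace (X ** Y))"

definition hs_norm :: "complex ^ 'n ^ 'n \<Rightarrow> real" where
  "hs_norm X = sqrt (hs_inner X X)"

definition lin_indep_with_id :: "nat \<Rightarrow> (nat \<Rightarrow> complex ^ 'n ^ 'n) \<Rightarrow> bool" where
  "lin_indep_with_id k H \<longleftrightarrow>
     inj_on H {1..k} \<and> mat 1 \<notin> H ` {1..k} \<and> independent (insert (mat 1) (H ` {1..k}))"

definition constraint_set ::
    "nat \<Rightarrow> (nat \<Rightarrow> complex ^ 'n ^ 'n) \<Rightarrow> (nat \<Rightarrow> real) \<Rightarrow> (complex ^ 'n ^ 'n) set" where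
  "constraint_set k H c =
     {\<rho> \<in> density_ops. \<forall>j\<in>{1..k}. trace (\<rho> ** H j) = complex_of_real (c j)}"

definition tangent_ops :: "nat \<Rightarrow> (nat \<Rightarrow> complex ^ 'n ^ 'n) \<Rightarrow> (complex ^ 'n ^ 'n) set" where
  "tangent_ops k H = {X. hermitian X \<and> trace X = 0 \<and> (\<forall>j\<in>{1..k}. trace (X ** H j) = 0)}"

definition normal_ops :: "nat \<Rightarrow> (nat \<Rightarrow> complex ^ 'n ^ 'n) \<Rightarrow> (complex ^ 'n ^ 'n) set" where
  "normal_ops k H = {Y. hermitian Y \<and> (\<forall>X\<in>tangent_ops k H. hs_inner X Y = 0)}"

text \<open>
  Differentiability relative to \<open>M\<close>: the filter \<open>at \<rho> within M\<close> only sees points of \<open>M\<close>, so the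
  gradient is determined only up to operators orthogonal to the directions of \<open>M\<close>.
  The norm implicit in \<open>has_derivative\<close> is the Hilbert--Schmidt norm (see \<open>hs_norm_eq_norm\<close>).
\<close>

definition is_gradient ::
    "(complex ^ 'n ^ 'n \<Rightarrow> real) \<Rightarrow> (complex ^ 'n ^ 'n) set \<Rightarrow> complex ^ 'n ^ 'n \<Rightarrow> complex ^ 'n ^ 'n \<Rightarrow> bool"
where
  "is_gradient f M \<rho> G \<longleftrightarrow> hermitian G \<and> (f has_derivative (\<lambda>X. hs_inner G X)) (at \<rho> within M)"

definition min_value :: "('a \<Rightarrow> real) \<Rightarrow> 'a set \<Rightarrow> real" where
  "min_value f M = (LEAST y. y \<in> f ` M)"

definition hs_setdist :: "complex ^ 'n ^ 'n \<Rightarrow> (complex ^ 'n ^ 'n) set \<Rightarrow> real" where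
  "hs_setdist Y N = (INF Z\<in>N. hs_norm (Y - Z))"

definition hs_radius :: "(complex ^ 'n ^ 'n) set \<Rightarrow> complex ^ 'n ^ 'n \<Rightarrow> real" where
  "hs_radius M \<rho> = (SUP \<sigma>\<in>M. hs_norm (\<rho> - \<sigma>))"

lemma hs_inner_eq_inner:
  assumes "hermitian X"
  shows "hs_inner X Y = X \<bullet> Y"
proof -
  have eq: "X $ i $ j * Y $ j $ i = cnj (X $ j $ i) * Y $ j $ i" for i j
    using assms[unfolded hermitian_def, rule_format, of i j] by simp
  have "hs_inner X Y = (\<Sum>i\<in>UNIV. \<Sum>j\<in>UNIV. Re (X $ i $ j * Y $ j $ i))"
    by (simp only: hs_inner_def trace_def matrix_matrix_mult_def vec_lambda_beta Re_sum)
  also have "\<dots> = (\<Sum>i\<in>UNIV. \<Sum>j\<in>UNIV. X $ j $ i \<bullet> Y $ j $ i)"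
    by (simp only: eq) (simp add: inner_complex_def)
  also have "\<dots> = X \<bullet> Y"
    by (subst sum.swap) (simp add: inner_vec_def)
  finally show ?thesis .
qed

lemma hs_norm_eq_norm: "hermitian X \<Longrightarrow> hs_norm X = norm X"
  by (simp add: hs_norm_def hs_inner_eq_inner norm_eq_sqrt_inner)

lemma subspace_hermitian: "subspace {A :: complex ^ 'n ^ 'n. hermitian A}"
proof -
  have *: "{A :: complex ^ 'n ^ 'n. hermitian A} = (\<Inter>i j. {A. A $ i $ j - cnj (A $ j $ i) = 0})"
    by (simp add: hermitian_def set_eq_iff)
  have "subspace {A :: complex ^ 'n ^ 'n. A $ i $ j - cnj (A $ j $ i) = 0}" for i j
    by (rule linear_subspace_kernel, rule linearI) (simp_all add: scaleR_diff_right)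
  then show ?thesis
    unfolding * by (intro subspace_Inter ballI) (auto intro!: subspace_Inter)
qed

lemma hermitian_mat_1: "hermitian (mat 1)"
  by (auto simp: hermitian_def mat_def)

lemma trace_hermitian_mult:
  assumes "hermitian X" "hermitian Y"
  shows "trace (X ** Y) = complex_of_real (hs_inner X Y)"
proof -
  have herm: "cnj (X $ i $ j) = X $ j $ i" "cnj (Y $ i $ j) = Y $ j $ i" for i j
    using assms[unfolded hermitian_def, THEN spec, of j, THEN spec, of i] by auto
  have "cnj (trace (X ** Y)) = (\<Sum>i\<in>UNIV. \<Sum>j\<in>UNIV. cnj (X $ i $ j) * cnj (Y $ j $ i))"
    by (simp add: trace_def matrix_matrix_mult_def)
  also have "\<dots> = (\<Sum>i\<in>UNIV. \<Sum>j\<in>UNIV. X $ j $ i * Y $ i $ j)"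
    by (simp only: herm)
  also have "\<dots> = trace (X ** Y)"
    by (subst sum.swap) (simp add: trace_def matrix_matrix_mult_def)
  finally show ?thesis
    by (simp add: hs_inner_def complex_eq_iff)
qed

lemma normal_ops_eq_span:
  assumes H: "\<forall>j\<in>{1..k}. hermitian (H j)"
  shows "normal_ops k H = span (insert (mat 1) (H ` {1..k}))"
proof -
  let ?S = "insert (mat 1) (H ` {1..k})"
  have S: "?S \<subseteq> {A. hermitian A}"
    using H hermitian_mat_1 by auto
  then have span: "span ?S \<subseteq> {A. hermitian A}"
    by (rule span_minimal[OF _ subspace_hermitian])
  have tangent: "X \<in> tangent_ops k H \<longleftrightarrow> hermitian X \<and> (\<forall>A\<in>?S. X \<bullet> A = 0)" for X
  proof (cases "hermitian X")
    case True
    have eq: "trace (X ** A) = 0 \<longleftrightarrow> X \<bullet> A = 0" if "A \<in> ?S" for A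
    proof -
      have "hermitian A"
        using that S by blast
      then show ?thesis
        using True by (simp add: trace_hermitian_mult hs_inner_eq_inner)
    qed
    have "trace X = 0 \<longleftrightarrow> X \<bullet> mat 1 = 0"
      using eq[of "mat 1"] by simp
    then show ?thesis
      using True eq by (auto simp: tangent_ops_def)
  qed (simp add: tangent_ops_def)
  show ?thesis
  proof (intro equalityI subsetI)
    fix Y assume Y: "Y \<in> normal_ops k H"
    obtain z w where zw: "z \<in> span ?S" "\<And>a. a \<in> span ?S \<Longrightarrow> orthogonal w a" "Y = z + w"
      using orthogonal_subspace_decomp_exists by metis
    have "hermitian (Y - z)"
      using Y zw(1) span subspace_diff[OF subspace_hermitian, of Y z] by (auto simp: normal_ops_def)
    then have "w \<in> tangent_ops k H"
      unfolding tangent using zw by (auto simp: orthogonal_def span_base)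
    then have "w \<bullet> Y = 0"
      using Y tangent[of w] hs_inner_eq_inner[of w Y] by (auto simp: normal_ops_def)
    moreover have "w \<bullet> z = 0"
      using zw by (simp add: orthogonal_def)
    ultimately have "w = 0"
      using zw(3) by (simp add: inner_add_right)
    then show "Y \<in> span ?S"
      using zw by simp
  next
    fix Y assume Y: "Y \<in> span ?S"
    have "X \<bullet> Y = 0" if "X \<in> tangent_ops k H" for X
    proof -
      have "orthogonal X Y"
        using that Y unfolding tangent
        by (intro orthogonal_to_span[OF Y]) (auto simp: orthogonal_def)
      then show ?thesis by (simp add: orthogonal_def)
    qed
    then show "Y \<in> normal_ops k H"
      using Y span by (auto simp: normal_ops_def hs_inner_eq_inner tangent)
  qed
qed

end

theory Submission
  imports Defs
begin

text \<open>
  The first-order condition for a convex \<open>f\<close> gives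
  \<open>f \<rho> - f \<sigma> \<le> \<langle>\<nabla>f \<rho>, \<rho> - \<sigma>\<rangle>\<close>; as \<open>\<rho> - \<sigma>\<close> is a tangent direction, \<open>\<nabla>f \<rho>\<close> may be replaced by
  \<open>\<nabla>f \<rho> - Z\<close> for any normal \<open>Z\<close>, and Cauchy--Schwarz yields the middle inequality.
  The radius is at most \<open>sqrt 2\<close> because density operators have norm at most \<open>1\<close> and
  nonnegative inner products.  The latter (self-duality of the positive semidefinite cone) is
  obtained without the spectral theorem, by splitting off rank-one Schur complements.
\<close>

section \<open>Positive semidefinite matrices\<close>

lemma pos_semidef_hermitian: "pos_semidef A \<Longrightarrow> hermitian A"
  by (simp add: pos_semidef_def)

lemma hermitianI: "(\<And>i j. cnj (A $ j $ i) = A $ i $ j) \<Longrightarrow> hermitian A"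
  by (simp add: hermitian_def)

lemma hermitian_cnj: "hermitian A \<Longrightarrow> cnj (A $ i $ j) = A $ j $ i"
  unfolding hermitian_def by metis

lemma hermitian_diff: "hermitian A \<Longrightarrow> hermitian B \<Longrightarrow> hermitian (A - B)"
  by (auto intro!: hermitianI simp: hermitian_cnj)

text \<open>Hermiticity makes the two cross terms conjugate to each other, hence the factor
  2.\<close>

lemma quad_form_add_axis:
  fixes A :: "complex ^ 'n ^ 'n"
  assumes "hermitian A"
  shows "Re (quad_form A (v + axis i t))
    = Re (quad_form A v) + 2 * Re (cnj t * (A *v v) $ i) + (cmod t)\<^sup>2 * Re (A $ i $ i)"
proof -
  have mult_axis: "(A *v axis i t) $ j = A $ j $ i * t" for j
    by (simp add: matrix_vector_mult_def axis_def if_distrib cong: if_cong)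
  have sum_axis: "(\<Sum>j\<in>UNIV. cnj (axis i t $ j) * g j) = cnj t * g i" for g
    by (simp add: axis_def if_distrib[of cnj] if_distrib[of "\<lambda>x. x * _"] cong: if_cong)
  have cross: "(\<Sum>j\<in>UNIV. cnj (v $ j) * (A $ j $ i * t)) = cnj (cnj t * (A *v v) $ i)"
    using assms by (simp add: matrix_vector_mult_def hermitian_cnj sum_distrib_left mult_ac)
  have "quad_form A (v + axis i t) = quad_form A v
      + cnj (cnj t * (A *v v) $ i) + cnj t * (A *v v) $ i + cnj t * (A $ i $ i * t)"
    unfolding quad_form_def matrix_vector_right_distrib vector_add_component complex_cnj_add
      distrib_left distrib_right sum.distrib sum_axis mult_axis cross by simp
  moreover have "cnj t * (A $ i $ i * t) = of_real ((cmod t)\<^sup>2) * A $ i $ i"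
    by (simp add: complex_norm_square mult_ac del: of_real_power)
  ultimately show ?thesis
    by (simp del: of_real_power)
qed

text \<open>This is Cauchy-Schwarz for the semi-inner product defined by \<open>A\<close>, applied
  to \<open>v\<close> and the \<open>i\<close>-th basis vector. It follows from nonnegativity of the
  form along the line through \<open>v\<close> in a multiple of that basis direction.\<close>

lemma pos_semidef_Cauchy_Schwarz:
  fixes A :: "complex ^ 'n ^ 'n"
  assumes "pos_semidef A"
  shows "(cmod ((A *v v) $ i))\<^sup>2 \<le> Re (A $ i $ i) * Re (quad_form A v)"
proof -
  define w a q where "w = (A *v v) $ i" and "a = Re (A $ i $ i)" and "q = Re (quad_form A v)"
  \<comment> \<open>The direction \<open>- of_real s * w\<close> makes the cross term real, which
    leaves a real polynomial in \<open>s\<close>.\<close>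
  have poly: "0 \<le> q - 2 * s * (cmod w)\<^sup>2 + s\<^sup>2 * (cmod w)\<^sup>2 * a" for s
  proof -
    have cross: "Re (cnj (- of_real s * w) * w) = - s * (cmod w)\<^sup>2"
      unfolding cmod_power2 by (simp add: power2_eq_square algebra_simps)
    have "0 \<le> Re (quad_form A (v + axis i (- of_real s * w)))"
      using assms by (simp add: pos_semidef_def)
    also have "\<dots> = q - 2 * s * (cmod w)\<^sup>2 + s\<^sup>2 * (cmod w)\<^sup>2 * a"
      unfolding quad_form_add_axis[OF pos_semidef_hermitian[OF assms]] w_def[symmetric]
        a_def[symmetric] q_def[symmetric] cross
      by (simp add: norm_mult power_mult_distrib)
    finally show ?thesis .
  qed
  have "Re (quad_form A (0 + axis i 1)) \<ge> 0"
    using assms by (simp add: pos_semidef_def)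
  then have "a \<ge> 0"
    unfolding quad_form_add_axis[OF pos_semidef_hermitian[OF assms]]
    by (simp add: a_def quad_form_def)
  show ?thesis
    unfolding w_def[symmetric] a_def[symmetric] q_def[symmetric]
  proof (cases "a = 0")
    case True
    show "(cmod w)\<^sup>2 \<le> a * q"
    proof (rule ccontr)
      assume "\<not> ?thesis"
      then have "w \<noteq> 0"
        using True by auto
      \<comment> \<open>For \<open>a = 0\<close> the polynomial is affine in \<open>s\<close>; the
        chosen \<open>s\<close> gives the value \<open>- q - 2\<close>, negative because
        \<open>s = 0\<close> yields \<open>q \<ge> 0\<close>.\<close>
      then show False
        using poly[of "(q + 1) / (cmod w)\<^sup>2"] poly[of 0] True by simp
    qed
  next
    case False
    with \<open>a \<ge> 0\<close> have "a > 0" by simp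
    \<comment> \<open>The value \<open>s = 1 / a\<close> minimizes the polynomial.\<close>
    then show "(cmod w)\<^sup>2 \<le> a * q"
      using poly[of "1 / a"] by (simp add: field_simps power2_eq_square)
  qed
qed

lemma
  fixes A :: "complex ^ 'n ^ 'n"
  assumes "pos_semidef A"
  shows pos_semidef_diag_nonneg: "0 \<le> Re (A $ i $ i)"
    and pos_semidef_minor: "(cmod (A $ i $ j))\<^sup>2 \<le> Re (A $ i $ i) * Re (A $ j $ j)"
proof -
  have quad: "Re (quad_form A (axis j 1)) = Re (A $ j $ j)" for j
    using quad_form_add_axis[OF pos_semidef_hermitian[OF assms], of 0 j 1]
    by (simp add: quad_form_def)
  show "0 \<le> Re (A $ i $ i)"
    using assms unfolding quad[symmetric] pos_semidef_def by simp
  have "(A *v axis j 1) $ i = A $ i $ j"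
    by (simp add: matrix_vector_mult_def axis_def if_distrib cong: if_cong)
  then show "(cmod (A $ i $ j))\<^sup>2 \<le> Re (A $ i $ i) * Re (A $ j $ j)"
    using pos_semidef_Cauchy_Schwarz[OF assms, of "axis j 1" i] quad by simp
qed

definition rank_one :: "complex ^ 'n \<Rightarrow> complex ^ 'n ^ 'n" where
  "rank_one a = (\<chi> i j. a $ i * cnj (a $ j))"

text \<open>Writing the form as an inner product makes its linearity in the matrix available, as
  needed for Schur complements.\<close>

lemma inner_rank_one: "rank_one a \<bullet> B = Re (quad_form B a)"
proof -
  have "rank_one a \<bullet> B = (\<Sum>i\<in>UNIV. \<Sum>j\<in>UNIV. Re (cnj (a $ i) * (B $ i $ j * a $ j)))"
    unfolding inner_vec_def rank_one_def vec_lambda_beta inner_complex_def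
    by (intro sum.cong refl) (simp add: algebra_simps)
  also have "\<dots> = Re (quad_form B a)"
    by (simp add: quad_form_def matrix_vector_mult_def sum_distrib_left)
  finally show ?thesis .
qed

lemma Re_quad_form_eq_inner: "Re (quad_form A v) = A \<bullet> rank_one v"
  by (metis inner_rank_one inner_commute)

lemma inner_rank_one_rank_one:
  "rank_one a \<bullet> rank_one v = (cmod (\<Sum>j\<in>UNIV. cnj (a $ j) * v $ j))\<^sup>2"
proof -
  let ?s = "\<Sum>j\<in>UNIV. cnj (a $ j) * v $ j"
  have "quad_form (rank_one a) v = (\<Sum>i\<in>UNIV. cnj (v $ i) * (a $ i * ?s))"
    by (simp add: quad_form_def matrix_vector_mult_def rank_one_def sum_distrib_left mult_ac)
  also have "\<dots> = cnj ?s * ?s"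
    by (simp add: sum_distrib_right mult_ac)
  also have "\<dots> = of_real ((cmod ?s)\<^sup>2)"
    by (simp add: complex_norm_square mult_ac del: of_real_power)
  finally show ?thesis
    by (simp add: Re_quad_form_eq_inner[symmetric])
qed

text \<open>Subtracting the rank-one term lowers the form at \<open>v\<close> by the squared modulus
  of \<open>(A *v v) $ i\<close> divided by the diagonal entry, and Cauchy-Schwarz bounds exactly
  this loss.\<close>

lemma pos_semidef_Schur_complement:
  fixes A :: "complex ^ 'n ^ 'n"
  assumes A: "pos_semidef A" and pos: "0 < Re (A $ i $ i)"
  shows "pos_semidef (A - (1 / Re (A $ i $ i)) *\<^sub>R rank_one (column i A))"
    (is "pos_semidef ?B")
proof -
  have herm: "hermitian A"
    using A by (rule pos_semidef_hermitian)
  have "hermitian (rank_one (column i A))"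
    by (rule hermitianI) (simp add: rank_one_def)
  then have "hermitian ?B"
    using herm subspace_diff[OF subspace_hermitian] subspace_scale[OF subspace_hermitian] by blast
  moreover have "0 \<le> Re (quad_form ?B v)" for v
  proof -
    have "(\<Sum>j\<in>UNIV. cnj (column i A $ j) * v $ j) = (A *v v) $ i"
      using herm by (simp add: matrix_vector_mult_def column_def hermitian_cnj)
    then have "Re (quad_form ?B v)
        = Re (quad_form A v) - (cmod ((A *v v) $ i))\<^sup>2 / Re (A $ i $ i)"
      by (simp add: Re_quad_form_eq_inner inner_diff_left inner_rank_one_rank_one)
    moreover have "(cmod ((A *v v) $ i))\<^sup>2 / Re (A $ i $ i) \<le> Re (quad_form A v)"
      using pos_semidef_Cauchy_Schwarz[OF A, of v i] pos by (simp add: field_simps)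
    ultimately show ?thesis by simp
  qed
  ultimately show ?thesis
    by (simp add: pos_semidef_def)
qed

text \<open>Induction on the number of nonzero diagonal entries. If there are none, the minors force
  \<open>A = 0\<close>. Otherwise a Schur complement has fewer of them, and the rank-one part
  removed pairs with \<open>B\<close> to a nonnegative value of the form of
  \<open>B\<close>.\<close>

lemma pos_semidef_inner_nonneg:
  fixes A B :: "complex ^ 'n ^ 'n"
  assumes "pos_semidef A" "pos_semidef B"
  shows "0 \<le> A \<bullet> B"
  using assms(1)
proof (induction "card {i. Re (A $ i $ i) \<noteq> 0}" arbitrary: A rule: less_induct)
  case (less A)
  show ?case
  proof (cases "\<forall>i. Re (A $ i $ i) = 0")
    case True
    then have "cmod (A $ i $ j) = 0" for i j
      using pos_semidef_minor[OF less.prems, of i j] by simp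
    then have "A = 0"
      by (simp add: vec_eq_iff)
    then show ?thesis by simp
  next
    case False
    then obtain i where i: "0 < Re (A $ i $ i)"
      using pos_semidef_diag_nonneg[OF less.prems] by (metis less_le)
    define C where "C = A - (1 / Re (A $ i $ i)) *\<^sub>R rank_one (column i A)"
    have C: "pos_semidef C"
      unfolding C_def using less.prems i by (rule pos_semidef_Schur_complement)
    have C_diag: "Re (C $ j $ j) = Re (A $ j $ j) - (cmod (A $ j $ i))\<^sup>2 / Re (A $ i $ i)" for j
      unfolding C_def cmod_power2 by (simp add: rank_one_def column_def power2_eq_square)
    \<comment> \<open>Since the pivot is real, the subtraction cancels it exactly.\<close>
    have "Im (A $ i $ i) = 0"
      using hermitian_cnj[OF pos_semidef_hermitian[OF less.prems], of i i]
      by (simp add: complex_eq_iff)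
    then have "Re (C $ i $ i) = 0"
      unfolding C_diag cmod_power2 using i by (simp add: power2_eq_square)
    \<comment> \<open>A zero diagonal entry forces \<open>A $ j $ i = 0\<close>, so existing zeros
      survive and the count drops strictly.\<close>
    moreover have "Re (C $ j $ j) = 0" if "Re (A $ j $ j) = 0" for j
      using pos_semidef_minor[OF less.prems, of j i] that unfolding C_diag by simp
    moreover have "Re (A $ i $ i) \<noteq> 0"
      using i by simp
    ultimately have "{j. Re (C $ j $ j) \<noteq> 0} \<subset> {j. Re (A $ j $ j) \<noteq> 0}"
      by blast
    then have "0 \<le> C \<bullet> B"
      by (intro less.hyps C psubset_card_mono) simp_all
    moreover have "0 \<le> Re (quad_form B (column i A))"
      using assms(2) by (simp add: pos_semidef_def)
    moreover have "A \<bullet> B = C \<bullet> B + Re (quad_form B (column i A)) / Re (A $ i $ i)"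
      by (simp add: C_def inner_diff_left inner_rank_one)
    ultimately show ?thesis
      using i by simp
  qed
qed

section \<open>Density operators and constraint sets\<close>

text \<open>Bounding each squared entry by its minor turns the double sum into the square of the
  trace.\<close>

lemma norm_density_le_1:
  assumes "\<rho> \<in> density_ops"
  shows "norm \<rho> \<le> 1"
proof -
  have psd: "pos_semidef \<rho>" and tr: "(\<Sum>i\<in>UNIV. Re (\<rho> $ i $ i)) = 1"
    using assms by (auto simp: density_ops_def trace_def simp flip: Re_sum)
  have "(norm \<rho>)\<^sup>2 = (\<Sum>i\<in>UNIV. \<Sum>j\<in>UNIV. (cmod (\<rho> $ i $ j))\<^sup>2)"
    by (simp add: power2_norm_eq_inner inner_vec_def)
  also have "\<dots> \<le> (\<Sum>i\<in>UNIV. \<Sum>j\<in>UNIV. Re (\<rho> $ i $ i) * Re (\<rho> $ j $ j))"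
    by (intro sum_mono pos_semidef_minor psd)
  also have "\<dots> = 1"
    by (simp add: tr flip: sum_distrib_left sum_distrib_right)
  finally show ?thesis
    by (simp add: power_le_one_iff abs_square_le_1)
qed

text \<open>Nonnegativity of the cross term improves the bound 2 of the triangle inequality to
  \<open>sqrt 2\<close>.\<close>

lemma norm_density_diff_le:
  assumes "\<rho> \<in> density_ops" "\<sigma> \<in> density_ops"
  shows "norm (\<rho> - \<sigma>) \<le> sqrt 2"
proof (rule real_le_rsqrt)
  have "(norm (\<rho> - \<sigma>))\<^sup>2 = (norm \<rho>)\<^sup>2 + (norm \<sigma>)\<^sup>2 - 2 * (\<rho> \<bullet> \<sigma>)"
    by (simp add: power2_norm_eq_inner inner_diff_left inner_diff_right inner_commute)
  moreover have "0 \<le> \<rho> \<bullet> \<sigma>"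
    using assms by (intro pos_semidef_inner_nonneg) (simp_all add: density_ops_def)
  moreover have "(norm \<rho>)\<^sup>2 \<le> 1" "(norm \<sigma>)\<^sup>2 \<le> 1"
    using assms by (simp_all add: norm_density_le_1 power_le_one)
  ultimately show "(norm (\<rho> - \<sigma>))\<^sup>2 \<le> 2"
    by simp
qed

lemma closed_density_ops: "closed (density_ops :: (complex ^ 'n ^ 'n) set)"
  unfolding density_ops_def pos_semidef_def hermitian_def quad_form_def matrix_vector_mult_def
    trace_def vec_lambda_beta
  by (intro closed_Collect_conj closed_Collect_all closed_Collect_eq closed_Collect_le
      continuous_intros)

text \<open>Compactness provides the minimizer of \<open>f\<close>.\<close>

lemma compact_constraint_set:
  fixes H :: "nat \<Rightarrow> complex ^ 'n ^ 'n"
  shows "compact (constraint_set k H c)"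
proof -
  have "closed {\<rho> :: complex ^ 'n ^ 'n. \<forall>j\<in>{1..k}. trace (\<rho> ** H j) = complex_of_real (c j)}"
    unfolding Ball_def trace_def matrix_matrix_mult_def vec_lambda_beta
    by (intro closed_Collect_all closed_Collect_imp open_Collect_const closed_Collect_eq
        continuous_intros)
  then have "closed (constraint_set k H c)"
    unfolding constraint_set_def Collect_conj_eq Collect_mem_eq
    by (intro closed_Int closed_density_ops)
  moreover have "bounded (constraint_set k H c)"
    by (rule boundedI[of _ 1]) (simp add: constraint_set_def norm_density_le_1)
  ultimately show ?thesis
    by (simp add: compact_eq_bounded_closed)
qed

lemma constraint_set_diff_tangent:
  assumes "\<rho> \<in> constraint_set k H c" "\<sigma> \<in> constraint_set k H c"
  shows "\<rho> - \<sigma> \<in> tangent_ops k H"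
proof -
  have "trace ((\<rho> - \<sigma>) ** A) = trace (\<rho> ** A) - trace (\<sigma> ** A)" for A
    by (simp add: trace_def matrix_matrix_mult_def left_diff_distrib sum_subtractf)
  then show ?thesis
    using assms
    by (auto simp: constraint_set_def density_ops_def tangent_ops_def trace_sub
        intro!: hermitian_diff intro: pos_semidef_hermitian)
qed

section \<open>The gap estimate\<close>

text \<open>Along the segment from \<open>x\<close> to \<open>y\<close>, convexity bounds every
  difference quotient at \<open>x\<close> by \<open>f y - f x\<close>; their limit is
  \<open>f' (y - x)\<close>.\<close>

lemma convex_on_has_derivative_ge:
  fixes f :: "'a::real_normed_vector \<Rightarrow> real"
  assumes f: "convex_on M f" and x: "x \<in> M" and y: "y \<in> M"
    and deriv: "(f has_derivative f') (at x within M)"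
  shows "f x + f' (y - x) \<le> f y"
proof -
  define g where "g = (\<lambda>t::real. x + t *\<^sub>R (y - x))"
  have g_eq: "g t = (1 - t) *\<^sub>R x + t *\<^sub>R y" for t
    by (simp add: g_def algebra_simps)
  have "g ` {0..1} \<subseteq> M"
    using convex_on_imp_convex[OF f] x y by (auto simp: g_eq intro!: convexD)
  \<comment> \<open>The derivative is known only within \<open>M\<close>, so the chain rule is
    applied within the segment, a subset of \<open>M\<close>.\<close>
  then have "(f has_derivative f') (at (g 0) within g ` {0..1})"
    using deriv by (auto simp: g_def intro: has_derivative_subset)
  moreover have "(g has_derivative (\<lambda>t. t *\<^sub>R (y - x))) (at 0 within {0..1})"
    unfolding g_def by (auto intro!: derivative_eq_intros)
  ultimately have "((\<lambda>t. f (g t)) has_derivative (\<lambda>t. f' (t *\<^sub>R (y - x)))) (at 0 within {0..1})"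
    by (rule has_derivative_in_compose[rotated])
  then have "((\<lambda>t. f (g t)) has_derivative (\<lambda>t. t * f' (y - x))) (at 0 within {0..1})"
    by (simp add: linear_cmul[OF has_derivative_linear[OF deriv]])
  then have "((\<lambda>t. f (g t)) has_field_derivative f' (y - x)) (at 0 within {0..1})"
    by (simp add: has_field_derivative_def mult_commute_abs)
  then have "((\<lambda>t. (f (g t) - f (g 0)) / (t - 0)) \<longlongrightarrow> f' (y - x)) (at 0 within {0..1})"
    by (simp add: has_field_derivative_iff)
  moreover have "\<forall>\<^sub>F t in at 0 within {0..1}. (f (g t) - f (g 0)) / (t - 0) \<le> f y - f x"
    unfolding eventually_at_filter
  proof (rule always_eventually, intro allI impI)
    fix t :: real assume t: "t \<noteq> 0" "t \<in> {0..1}"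
    then have "f (g t) \<le> (1 - t) * f x + t * f y"
      unfolding g_eq using f x y by (intro convex_onD) auto
    then show "(f (g t) - f (g 0)) / (t - 0) \<le> f y - f x"
      using t by (simp add: g_def field_simps)
  qed
  \<comment> \<open>A nontrivial filter is needed to pass the inequality to the limit; at the
    endpoint 0 it is the right-sided one.\<close>
  moreover have "at (0::real) within {0..1} \<noteq> bot"
    by (simp add: at_within_Icc_at_right)
  ultimately have "f' (y - x) \<le> f y - f x"
    by (intro tendsto_upperbound)
  then show ?thesis by simp
qed

text \<open>A normal \<open>Z\<close> is orthogonal to \<open>X\<close>, so it can be subtracted
  from \<open>G\<close> before Cauchy-Schwarz. Keeping \<open>Z\<close> arbitrary allows an infimum
  over it later.\<close>

lemma hs_inner_tangent_le:
  assumes X: "X \<in> tangent_ops k H" and G: "hermitian G" and Z: "Z \<in> normal_ops k H"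
  shows "hs_inner G X \<le> norm X * hs_norm (G - Z)"
proof -
  have hX: "hermitian X" and hZ: "hermitian Z" and "hs_inner X Z = 0"
    using X Z by (auto simp: tangent_ops_def normal_ops_def)
  then have "hs_inner G X = X \<bullet> (G - Z)"
    using G by (simp add: hs_inner_eq_inner inner_diff_right inner_commute)
  also have "\<dots> \<le> norm X * norm (G - Z)"
    by (rule norm_cauchy_schwarz)
  finally show ?thesis
    using G hZ by (simp add: hs_norm_eq_norm hermitian_diff)
qed

text \<open>\<open>LEAST\<close> over the reals is informative only for an attained minimum, so it
  is evaluated at a minimizer.\<close>

lemma min_value_eqI:
  assumes "\<sigma> \<in> M" "\<And>\<tau>. \<tau> \<in> M \<Longrightarrow> f \<sigma> \<le> f \<tau>"
  shows "min_value f M = f \<sigma>"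
  unfolding min_value_def using assms by (intro Least_equality) auto

theorem theorem15:
  fixes H :: "nat \<Rightarrow> complex ^ 'n ^ 'n"
    and c :: "nat \<Rightarrow> real"
    and k :: nat
    and \<Omega> :: "complex ^ 'n ^ 'n \<Rightarrow> complex ^ 'n ^ 'n"
    and M :: "(complex ^ 'n ^ 'n) set"
    and f :: "complex ^ 'n ^ 'n \<Rightarrow> real"
    and grad_f :: "complex ^ 'n ^ 'n \<Rightarrow> complex ^ 'n ^ 'n"
    and \<epsilon> R :: "complex ^ 'n ^ 'n \<Rightarrow> real"
  assumes herm: "\<forall>j\<in>{1..k}. hermitian (H j)"
    and indep: "lin_indep_with_id k H"
    and M_def: "M = constraint_set k H c"
    and pd: "\<exists>\<rho>\<in>M. pos_definite \<rho>"
    and Omega_herm: "\<forall>\<rho>\<in>density_ops. hermitian (\<Omega> \<rho>)"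
    and Omega_cont: "continuous_on density_ops \<Omega>"
    and f_def: "f = (\<lambda>\<rho>. Re (trace (\<rho> ** \<Omega> \<rho>)))"
    and f_convex: "convex_on M f"
    and f_diff: "\<forall>\<rho>\<in>M. is_gradient f M \<rho> (grad_f \<rho>)"
    and eps_def: "\<epsilon> = (\<lambda>\<rho>. hs_setdist (grad_f \<rho>) (normal_ops k H))"
    and R_def: "R = hs_radius M"
  shows "(\<exists>\<sigma>\<in>M. \<forall>\<tau>\<in>M. f \<sigma> \<le> f \<tau>) \<and>
    (\<forall>\<rho>\<in>M. 0 \<le> f \<rho> - min_value f M \<and>
           f \<rho> - min_value f M \<le> R \<rho> * \<epsilon> \<rho> \<and>
           R \<rho> * \<epsilon> \<rho> \<le> sqrt 2 * \<epsilon> \<rho>)"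
proof -
  have herm_M: "hermitian \<rho>" and dens_M: "\<rho> \<in> density_ops" if "\<rho> \<in> M" for \<rho>
    using that by (auto simp: M_def constraint_set_def density_ops_def pos_semidef_hermitian)
  have deriv: "(f has_derivative hs_inner (grad_f \<rho>)) (at \<rho> within M)"
    and herm_grad: "hermitian (grad_f \<rho>)" if "\<rho> \<in> M" for \<rho>
    using f_diff that by (auto simp: is_gradient_def)
  have "continuous_on M f"
    using deriv by (rule has_derivative_continuous_on)
  moreover have "compact M" "M \<noteq> {}"
    using compact_constraint_set pd by (auto simp: M_def)
  ultimately obtain \<sigma> where \<sigma>: "\<sigma> \<in> M" and min: "\<And>\<tau>. \<tau> \<in> M \<Longrightarrow> f \<sigma> \<le> f \<tau>"
    using continuous_attains_inf by metis
  have min_value: "min_value f M = f \<sigma>"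
    using \<sigma> min by (rule min_value_eqI)
  have norm_eq: "hs_norm (\<rho> - \<tau>) = norm (\<rho> - \<tau>)" if "\<rho> \<in> M" "\<tau> \<in> M" for \<rho> \<tau>
    using that herm_M by (intro hs_norm_eq_norm hermitian_diff)
  have norm_le: "hs_norm (\<rho> - \<tau>) \<le> sqrt 2" if "\<rho> \<in> M" "\<tau> \<in> M" for \<rho> \<tau>
    using that by (simp add: norm_eq norm_density_diff_le dens_M)
  \<comment> \<open>This makes the infimum defining \<open>\<epsilon>\<close> range over a nonempty
    set.\<close>
  have zero_normal: "0 \<in> normal_ops k H"
    by (simp add: normal_ops_eq_span[OF herm] span_zero)
  have bounds: "f \<rho> - f \<sigma> \<le> R \<rho> * \<epsilon> \<rho> \<and> R \<rho> * \<epsilon> \<rho> \<le> sqrt 2 * \<epsilon> \<rho>" if \<rho>: "\<rho> \<in> M" for \<rho>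
  proof -
    \<comment> \<open>The real supremum \<open>R \<rho>\<close> dominates its members only once
      boundedness is known.\<close>
    have bdd: "bdd_above ((\<lambda>\<tau>. hs_norm (\<rho> - \<tau>)) ` M)"
      using norm_le[OF \<rho>] by (intro bdd_aboveI2)
    have R_le: "R \<rho> \<le> sqrt 2"
      unfolding R_def hs_radius_def using norm_le[OF \<rho>] \<sigma> by (intro cSUP_least) auto
    have R_ge: "norm (\<rho> - \<sigma>) \<le> R \<rho>"
      unfolding R_def hs_radius_def norm_eq[OF \<rho> \<sigma>, symmetric] using \<sigma> bdd
      by (intro cSUP_upper)
    have nonneg: "0 \<le> hs_norm (grad_f \<rho> - Z)" if "Z \<in> normal_ops k H" for Z
    proof -
      have "hermitian (grad_f \<rho> - Z)"
        using that herm_grad[OF \<rho>] by (intro hermitian_diff) (auto simp: normal_ops_def)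
      then show ?thesis by (simp add: hs_norm_eq_norm)
    qed
    have eps_ge: "0 \<le> \<epsilon> \<rho>"
      unfolding eps_def hs_setdist_def using nonneg zero_normal by (intro cINF_greatest) auto
    have tangent: "\<rho> - \<sigma> \<in> tangent_ops k H"
      using \<rho> \<sigma> by (auto simp: M_def constraint_set_diff_tangent)
    have "hs_inner (grad_f \<rho>) (\<sigma> - \<rho>) = - hs_inner (grad_f \<rho>) (\<rho> - \<sigma>)"
      by (simp add: hs_inner_eq_inner herm_grad[OF \<rho>] inner_diff_right)
    then have gap: "f \<rho> - f \<sigma> \<le> hs_inner (grad_f \<rho>) (\<rho> - \<sigma>)"
      using convex_on_has_derivative_ge[OF f_convex \<rho> \<sigma> deriv[OF \<rho>]] by simp
    have gap_le: "f \<rho> - f \<sigma> \<le> R \<rho> * hs_norm (grad_f \<rho> - Z)" if Z: "Z \<in> normal_ops k H" for Z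
      using gap hs_inner_tangent_le[OF tangent herm_grad[OF \<rho>] Z]
        mult_right_mono[OF R_ge nonneg[OF Z]] by linarith
    have "f \<rho> - f \<sigma> \<le> R \<rho> * \<epsilon> \<rho>"
    \<comment> \<open>Passing to the infimum over \<open>Z\<close> divides by
      \<open>R \<rho>\<close>. If the radius is zero, \<open>Z = 0\<close> already shows that the
      gap is at most zero.\<close>
    proof (cases "R \<rho> = 0")
      case True
      then show ?thesis
        using gap_le[OF zero_normal] by simp
    next
      case False
      then have R_pos: "0 < R \<rho>"
        using R_ge norm_ge_zero[of "\<rho> - \<sigma>"] by linarith
      then have "(f \<rho> - f \<sigma>) / R \<rho> \<le> \<epsilon> \<rho>"
        unfolding eps_def hs_setdist_def using gap_le zero_normal
        by (intro cINF_greatest) (auto simp: field_simps)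
      then show ?thesis
        using R_pos by (simp add: field_simps)
    qed
    then show ?thesis
      using R_le eps_ge by (simp add: mult_right_mono)
  qed
  show ?thesis
    using \<sigma> min bounds by (auto simp: min_value)
qed

end
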